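(* Let $n$ be a positive integer. Suppose that $S=b^ra^A\subseteq BS(1,n)$ and $T=b^sa^B\subseteq BS(1,n)$, where $r,s\in\mathbb{N}$ and $A,B$ are finite subsets of $\mathbb{Z}$. Then $$ST=b^{r+s}a^{n^s\ast A+B}\qquad\text{and}\qquad |ST|=|n^s\ast A+B|.$$ In particular, $S^2=b^{2r}a^{n^r\ast A+A}$ and $|S^2|=|n^r\ast A+A|$.
   Context: $\mathbb{N}$ denotes the non-negative integers. $BS(1,n)=\langle a,b\mid ab=ba^n\rangle$ is the Baumslag-Solitar group. For a finite set $A\subseteq\mathbb{Z}$ and $r\in\mathbb{N}$, $b^ra^A=\{b^ra^x: x\in A\}$. For subsets $S,T$ of a group, $ST=\{st: s\in S, t\in T\}$ and $S^2=SS=\{s_1s_2: s_1,s_2\in S\}$. For a positive integer $q$ and a finite set $A\subseteq\mathbb{Z}$, $q\ast A=\{qx: x\in A\}$; for finite $A,B\subseteq\mathbb{Z}$, $A+B=\{x+y: x\in A, y\in B\}$. $|X|$ denotes the size of a finite set $X$. *)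

theory Defs
  imports "HOL-Algebra.Coset" "HOL-Library.Set_Algebras"
begin

text \<open>
  A word is a list of signed letters: \<open>(x, True)\<close> stands for the generator \<open>x\<close> and
  \<open>(x, False)\<close> for its formal inverse. The generators are all elements of the type \<open>'x\<close>,
  and a pair \<open>(u, v)\<close> of words in \<open>R\<close> is the defining relation \<open>u = v\<close>.
\<close>

type_synonym 'x word = "('x \<times> bool) list"

inductive pres_eq :: "('x word \<times> 'x word) set \<Rightarrow> 'x word \<Rightarrow> 'x word \<Rightarrow> bool"
  for R :: "('x word \<times> 'x word) set" where
  relator: "(u, v) \<in> R \<Longrightarrow> pres_eq R u v"
| cancel: "pres_eq R [(x, e), (x, \<not> e)] []"
| refl: "pres_eq R u u"
| sym: "pres_eq R u v \<Longrightarrow> pres_eq R v u"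
| trans: "pres_eq R u v \<Longrightarrow> pres_eq R v w \<Longrightarrow> pres_eq R u w"
| append: "pres_eq R u v \<Longrightarrow> pres_eq R u' v' \<Longrightarrow> pres_eq R (u @ u') (v @ v')"

definition pres_class :: "('x word \<times> 'x word) set \<Rightarrow> 'x word \<Rightarrow> 'x word set"
  where "pres_class R u = {v. pres_eq R u v}"

definition presented_group :: "('x word \<times> 'x word) set \<Rightarrow> 'x word set monoid"
  where "presented_group R =
    \<lparr>carrier = range (pres_class R),
     mult = (\<lambda>U V. \<Union>u\<in>U. \<Union>v\<in>V. pres_class R (u @ v)),
     one = pres_class R []\<rparr>"

lemma pres_class_eq_iff: "pres_class R u = pres_class R v \<longleftrightarrow> pres_eq R u v"
proof
  assume "pres_class R u = pres_class R v"
  then have "v \<in> pres_class R u"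
    by (simp add: pres_class_def pres_eq.refl)
  then show "pres_eq R u v" by (simp add: pres_class_def)
next
  assume uv: "pres_eq R u v"
  have "pres_eq R u w \<longleftrightarrow> pres_eq R v w" for w
    using pres_eq.trans[OF uv] pres_eq.trans[OF pres_eq.sym[OF uv]] by metis
  then show "pres_class R u = pres_class R v" by (simp add: pres_class_def)
qed

lemma carrier_presented_group: "carrier (presented_group R) = range (pres_class R)"
  by (simp add: presented_group_def)

lemma one_presented_group: "\<one>\<^bsub>presented_group R\<^esub> = pres_class R []"
  by (simp add: presented_group_def)

lemma mult_presented_group:
  "pres_class R u \<otimes>\<^bsub>presented_group R\<^esub> pres_class R v = pres_class R (u @ v)"
proof -
  have "pres_class R (u' @ v') = pres_class R (u @ v)"
    if "u' \<in> pres_class R u" "v' \<in> pres_class R v" for u' v'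
    using that unfolding pres_class_eq_iff
    by (simp add: pres_class_def pres_eq.append pres_eq.sym)
  moreover have "u \<in> pres_class R u" "v \<in> pres_class R v"
    by (simp_all add: pres_class_def pres_eq.refl)
  ultimately have "(\<Union>u'\<in>pres_class R u. \<Union>v'\<in>pres_class R v. pres_class R (u' @ v'))
      = pres_class R (u @ v)"
    by blast
  then show ?thesis by (simp add: presented_group_def)
qed

lemma pres_eq_left_inverse:
  "pres_eq R (rev (map (\<lambda>(x, e). (x, \<not> e)) w) @ w) []"
proof (induction w)
  case Nil
  show ?case by (simp add: pres_eq.refl)
next
  case (Cons p w)
  obtain x e where p: "p = (x, e)" by (cases p)
  define w' where "w' = rev (map (\<lambda>(x, e). (x, \<not> e)) w)"
  have "pres_eq R [(x, \<not> e), (x, e)] []"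
    using pres_eq.cancel[of R x "\<not> e"] by simp
  then have "pres_eq R (w' @ ([(x, \<not> e), (x, e)] @ w)) (w' @ ([] @ w))"
    by (intro pres_eq.append pres_eq.refl)
  moreover have "pres_eq R (w' @ ([] @ w)) []"
    using Cons.IH by (simp add: w'_def)
  ultimately have "pres_eq R (w' @ ([(x, \<not> e), (x, e)] @ w)) []"
    by (rule pres_eq.trans)
  then show ?case by (simp add: p w'_def)
qed

lemma group_presented_group: "group (presented_group R)"
proof (rule groupI)
  fix U assume "U \<in> carrier (presented_group R)"
  then obtain u where u: "U = pres_class R u"
    by (auto simp: carrier_presented_group)
  have "pres_class R (rev (map (\<lambda>(x, e). (x, \<not> e)) u)) \<otimes>\<^bsub>presented_group R\<^esub> U
      = \<one>\<^bsub>presented_group R\<^esub>"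
    by (simp only: u mult_presented_group one_presented_group pres_class_eq_iff
        pres_eq_left_inverse)
  then show "\<exists>V\<in>carrier (presented_group R). V \<otimes>\<^bsub>presented_group R\<^esub> U = \<one>\<^bsub>presented_group R\<^esub>"
    by (auto simp: carrier_presented_group)
qed (auto simp: carrier_presented_group one_presented_group mult_presented_group)


datatype bs_gen = Gen_a | Gen_b

definition bs_relators :: "nat \<Rightarrow> (bs_gen word \<times> bs_gen word) set"
  where "bs_relators n =
    {([(Gen_a, True), (Gen_b, True)], (Gen_b, True) # replicate n (Gen_a, True))}"

definition BS :: "nat \<Rightarrow> bs_gen word set monoid"
  where "BS n = presented_group (bs_relators n)"

definition bs_a :: "nat \<Rightarrow> bs_gen word set"
  where "bs_a n = pres_class (bs_relators n) [(Gen_a, True)]"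

definition bs_b :: "nat \<Rightarrow> bs_gen word set"
  where "bs_b n = pres_class (bs_relators n) [(Gen_b, True)]"

lemma group_BS: "group (BS n)"
  by (simp add: BS_def group_presented_group)

lemma bs_a_in_BS: "bs_a n \<in> carrier (BS n)" and bs_b_in_BS: "bs_b n \<in> carrier (BS n)"
  by (simp_all add: BS_def bs_a_def bs_b_def carrier_presented_group)

lemma BS_relation:
  "bs_a n \<otimes>\<^bsub>BS n\<^esub> bs_b n = bs_b n \<otimes>\<^bsub>BS n\<^esub> (bs_a n [^]\<^bsub>BS n\<^esub> n)"
proof -
  define R where "R = bs_relators n"
  have pow: "pres_class R [(Gen_a, True)] [^]\<^bsub>presented_group R\<^esub> k
      = pres_class R (replicate k (Gen_a, True))" for k :: nat
  proof (induction k)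
    case 0
    show ?case by (simp add: one_presented_group)
  next
    case (Suc k)
    then show ?case
      by (simp add: mult_presented_group replicate_append_same)
  qed
  have "pres_eq R [(Gen_a, True), (Gen_b, True)] ((Gen_b, True) # replicate n (Gen_a, True))"
    by (rule pres_eq.relator) (simp add: R_def bs_relators_def)
  then show ?thesis
    unfolding BS_def bs_a_def bs_b_def R_def[symmetric] pow mult_presented_group
    by (simp add: pres_class_eq_iff)
qed

definition bs_set :: "nat \<Rightarrow> nat \<Rightarrow> int set \<Rightarrow> bs_gen word set set"
  where "bs_set n r A = {(bs_b n [^]\<^bsub>BS n\<^esub> r) \<otimes>\<^bsub>BS n\<^esub> (bs_a n [^]\<^bsub>BS n\<^esub> x) |x. x \<in> A}"

end

theory Submission
  imports Defs Complex_Main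
begin

text \<open>
  The relation gives \<open>a^x b^s = b^s a^(n^s x)\<close>, which yields the set identities. For the
  cardinalities it remains to see that \<open>a\<close> has infinite order: \<open>BS(1,n)\<close> acts on the
  rational line, \<open>a\<close> by \<open>x \<mapsto> x + 1\<close> and \<open>b\<close> by \<open>x \<mapsto> x / n\<close>.
\<close>

context group
begin

text \<open>For natural exponents, induction pushes one \<open>a\<close> at a time through
  \<open>b\<close>. Negative exponents follow because \<open>u \<otimes> b = b \<otimes> v\<close>
  also holds for the inverses of \<open>u\<close> and \<open>v\<close>.\<close>

lemma int_pow_mult_twist:
  fixes n :: nat and x :: int
  assumes a: "a \<in> carrier G" and b: "b \<in> carrier G" and rel: "a \<otimes> b = b \<otimes> a [^] n"
  shows "a [^] x \<otimes> b = b \<otimes> a [^] (int n * x)"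
proof -
  have nat_case: "a [^] k \<otimes> b = b \<otimes> a [^] (n * k)" for k :: nat
  proof (induction k)
    case 0
    then show ?case using b by simp
  next
    case (Suc k)
    have "a [^] Suc k \<otimes> b = a [^] k \<otimes> b \<otimes> a [^] n"
      using a b by (simp add: m_assoc rel)
    also have "\<dots> = b \<otimes> a [^] (n * k + n)"
      using a b by (simp add: Suc.IH m_assoc nat_pow_mult)
    finally show ?case by (simp add: add.commute)
  qed
  show ?thesis
  proof (cases x)
    case (nonneg k)
    have "int n * x = int (n * k)" by (simp add: nonneg)
    then show ?thesis using nat_case[of k] by (simp only: nonneg int_pow_int)
  next
    case (neg j)
    \<comment> \<open>The case \<open>neg j\<close> means \<open>x = - int (Suc j)\<close>, hence
      the exponent \<open>Suc j\<close>.\<close>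
    define u v where "u = a [^] Suc j" and "v = a [^] (n * Suc j)"
    have uv: "u \<in> carrier G" "v \<in> carrier G" "u \<otimes> b = b \<otimes> v"
      using a nat_case[of "Suc j"] by (simp_all only: u_def v_def nat_pow_closed)
    \<comment> \<open>Inserting \<open>v \<otimes> inv v\<close> creates the factor
      \<open>b \<otimes> v\<close>, which turns back into \<open>u \<otimes> b\<close> and lets
      \<open>inv u\<close> cancel.\<close>
    have "inv u \<otimes> b = inv u \<otimes> (b \<otimes> v) \<otimes> inv v"
      using uv b by (simp add: m_assoc)
    also have "\<dots> = b \<otimes> inv v"
      using uv(1,2) b by (simp add: uv(3)[symmetric] m_assoc[symmetric])
    finally have "inv u \<otimes> b = b \<otimes> inv v" .
    moreover have "a [^] x = inv u"
      using a by (simp only: neg int_pow_neg int_pow_int u_def)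
    moreover have "int n * x = - int (n * Suc j)" by (simp add: neg algebra_simps)
    then have "a [^] (int n * x) = inv v"
      using a by (simp only: int_pow_neg int_pow_int v_def)
    ultimately show ?thesis by simp
  qed
qed

text \<open>Each of the \<open>s\<close> factors \<open>b\<close> that a power of \<open>a\<close>
  passes multiplies its exponent by \<open>n\<close>.\<close>

lemma int_pow_mult_pow_twist:
  fixes n s :: nat and x :: int
  assumes a: "a \<in> carrier G" and b: "b \<in> carrier G" and rel: "a \<otimes> b = b \<otimes> a [^] n"
  shows "a [^] x \<otimes> b [^] s = b [^] s \<otimes> a [^] (int n ^ s * x)"
proof (induction s)
  case 0
  then show ?case using a by simp
next
  case (Suc s)
  have "a [^] x \<otimes> b [^] Suc s = b [^] s \<otimes> (a [^] (int n ^ s * x) \<otimes> b)"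
    using a b by (simp add: Suc.IH m_assoc[symmetric])
  also have "\<dots> = b [^] Suc s \<otimes> a [^] (int n ^ Suc s * x)"
    using a b by (simp add: int_pow_mult_twist[OF a b rel] m_assoc mult.assoc)
  finally show ?case .
qed

lemma normal_form_mult:
  fixes n r s :: nat and x y :: int
  assumes a: "a \<in> carrier G" and b: "b \<in> carrier G" and rel: "a \<otimes> b = b \<otimes> a [^] n"
  shows "(b [^] r \<otimes> a [^] x) \<otimes> (b [^] s \<otimes> a [^] y)
    = b [^] (r + s) \<otimes> a [^] (int n ^ s * x + y)"
proof -
  have "(b [^] r \<otimes> a [^] x) \<otimes> (b [^] s \<otimes> a [^] y)
      = b [^] r \<otimes> (a [^] x \<otimes> b [^] s) \<otimes> a [^] y"
    using a b by (simp add: m_assoc)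
  also have "\<dots> = (b [^] r \<otimes> b [^] s) \<otimes> (a [^] (int n ^ s * x) \<otimes> a [^] y)"
    using a b by (simp add: int_pow_mult_pow_twist[OF a b rel] m_assoc)
  finally show ?thesis
    using a b by (simp add: nat_pow_mult int_pow_mult)
qed

text \<open>A coincidence \<open>a [^] x = a [^] y\<close> with \<open>x < y\<close> would make the
  positive power \<open>y - x\<close> of \<open>a\<close> trivial. Natural exponents suffice in
  \<open>ord\<close>, and these correspond to plain words in the letter \<open>a\<close>.\<close>

lemma inj_int_pow:
  assumes a: "a \<in> carrier G" and ord: "\<And>k :: nat. a [^] k = \<one> \<Longrightarrow> k = 0"
  shows "inj (\<lambda>x :: int. a [^] x)"
proof -
  have le: "y \<le> x" if "a [^] x = a [^] y" for x y :: int
  proof (rule ccontr)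
    assume "\<not> y \<le> x"
    then have "a [^] nat (y - x) = a [^] (y - x)"
      by (simp flip: int_pow_int)
    also have "\<dots> = \<one>"
      using a that by (simp add: int_pow_diff)
    finally show False using ord \<open>\<not> y \<le> x\<close> by fastforce
  qed
  show ?thesis by (rule injI) (simp add: le order.antisym)
qed

end

text \<open>The rightmost letter of a word will act first, so \<open>b\<close> has to divide:
  \<open>a b\<close> gives \<open>x / n + 1\<close> and \<open>b a^n\<close> gives
  \<open>(x + n) / n\<close>. Multiplication by \<open>n\<close> would not respect the relation in
  this order.\<close>

fun bs_letter_act :: "nat \<Rightarrow> bs_gen \<times> bool \<Rightarrow> rat \<Rightarrow> rat" where
  "bs_letter_act n (Gen_a, e) x = (if e then x + 1 else x - 1)"
| "bs_letter_act n (Gen_b, e) x = (if e then x / of_nat n else x * of_nat n)"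

definition bs_act :: "nat \<Rightarrow> bs_gen word \<Rightarrow> rat \<Rightarrow> rat"
  where "bs_act n w = foldr (bs_letter_act n) w"

lemma bs_act_append: "bs_act n (u @ v) x = bs_act n u (bs_act n v x)"
  by (simp add: bs_act_def)

lemma bs_act_replicate_a: "bs_act n (replicate k (Gen_a, True)) x = x + of_nat k"
  by (induction k) (simp_all add: bs_act_def)

text \<open>Acting by functions is compatible with concatenation, so only the relator and the
  cancelling pairs need a computation. For the pairs in \<open>b\<close>, \<open>n \<ge> 1\<close>
  makes multiplication and division by \<open>n\<close> mutually inverse.\<close>

lemma bs_act_pres_eq:
  assumes "pres_eq (bs_relators n) u v" and "n \<ge> 1"
  shows "bs_act n u = bs_act n v"
  using assms(1)
proof induction
  case (relator u v)
  then have uv: "u = [(Gen_a, True), (Gen_b, True)]"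
      "v = [(Gen_b, True)] @ replicate n (Gen_a, True)"
    by (simp_all add: bs_relators_def)
  show ?case
    unfolding uv fun_eq_iff bs_act_append bs_act_replicate_a
    using assms(2) by (simp add: bs_act_def field_simps)
next
  case (cancel x e)
  then show ?case
    using assms(2) by (cases x) (simp_all add: bs_act_def fun_eq_iff)
next
  case (append u v u' v')
  then show ?case by (simp add: fun_eq_iff bs_act_append)
qed simp_all

lemma bs_a_pow: "bs_a n [^]\<^bsub>BS n\<^esub> (k :: nat) = pres_class (bs_relators n) (replicate k (Gen_a, True))"
proof (induction k)
  case 0
  show ?case by (simp add: BS_def one_presented_group)
next
  case (Suc k)
  then show ?case
    by (simp add: BS_def bs_a_def mult_presented_group replicate_append_same)
qed

lemma bs_a_infinite_order:
  assumes "n \<ge> 1" and "bs_a n [^]\<^bsub>BS n\<^esub> (k :: nat) = \<one>\<^bsub>BS n\<^esub>"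
  shows "k = 0"
proof -
  have "pres_eq (bs_relators n) (replicate k (Gen_a, True)) []"
    using assms(2) unfolding bs_a_pow by (simp add: BS_def one_presented_group pres_class_eq_iff)
  \<comment> \<open>The orbit of 0 detects the exponent: \<open>a^k\<close> sends 0 to
    \<open>k\<close>, the empty word fixes it.\<close>
  then have "bs_act n (replicate k (Gen_a, True)) 0 = bs_act n [] 0"
    using bs_act_pres_eq assms(1) by metis
  then show ?thesis unfolding bs_act_replicate_a by (simp add: bs_act_def)
qed

text \<open>The map from \<open>x\<close> to \<open>b^r a^x\<close> is injective: cancel
  \<open>b^r\<close> on the left and use that \<open>a\<close> has infinite order.\<close>

lemma card_bs_set:
  assumes "n \<ge> 1"
  shows "card (bs_set n r A) = card A"
proof -
  interpret group "BS n" by (rule group_BS)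
  let ?f = "\<lambda>x :: int. (bs_b n [^]\<^bsub>BS n\<^esub> r) \<otimes>\<^bsub>BS n\<^esub> (bs_a n [^]\<^bsub>BS n\<^esub> x)"
  have "inj (\<lambda>x :: int. bs_a n [^]\<^bsub>BS n\<^esub> x)"
    using bs_a_infinite_order[OF assms] by (intro inj_int_pow bs_a_in_BS)
  then have "inj_on ?f A"
    by (auto simp: inj_on_def bs_a_in_BS bs_b_in_BS)
  moreover have "bs_set n r A = ?f ` A" by (auto simp: bs_set_def)
  ultimately show ?thesis by (simp add: card_image)
qed

lemma bs_set_mult:
  "bs_set n r A <#>\<^bsub>BS n\<^esub> bs_set n s B = bs_set n (r + s) (((int n ^ s) *o A) + B)"
proof -
  interpret group "BS n" by (rule group_BS)
  note nf = normal_form_mult[OF bs_a_in_BS bs_b_in_BS BS_relation]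
  have "bs_set n r A <#>\<^bsub>BS n\<^esub> bs_set n s B =
    {(bs_b n [^]\<^bsub>BS n\<^esub> r \<otimes>\<^bsub>BS n\<^esub> bs_a n [^]\<^bsub>BS n\<^esub> x) \<otimes>\<^bsub>BS n\<^esub>
      (bs_b n [^]\<^bsub>BS n\<^esub> s \<otimes>\<^bsub>BS n\<^esub> bs_a n [^]\<^bsub>BS n\<^esub> y) |x y. x \<in> A \<and> y \<in> B}"
    unfolding set_mult_def bs_set_def by blast
  also have "\<dots> = bs_set n (r + s) (((int n ^ s) *o A) + B)"
    unfolding nf bs_set_def elt_set_times_def set_plus_def by blast
  finally show ?thesis .
qed

theorem theorem1:
  fixes n r s :: nat and A B :: "int set" and S T :: "bs_gen word set set"
  assumes "n \<ge> 1"
    and "finite A" and "finite B"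
    and "S = bs_set n r A" and "T = bs_set n s B"
  shows "(S <#>\<^bsub>BS n\<^esub> T = bs_set n (r + s) (((int n ^ s) *o A) + B)
      \<and> card (S <#>\<^bsub>BS n\<^esub> T) = card (((int n ^ s) *o A) + B))
    \<and> (S <#>\<^bsub>BS n\<^esub> S = bs_set n (2 * r) (((int n ^ r) *o A) + A)
      \<and> card (S <#>\<^bsub>BS n\<^esub> S) = card (((int n ^ r) *o A) + A))"
  \<comment> \<open>The statement on squares is the product formula with \<open>B = A\<close> and
    \<open>s = r\<close>; \<open>mult_2\<close> matches \<open>r + r\<close> with
    \<open>2 * r\<close>.\<close>
  unfolding assms(4,5) bs_set_mult card_bs_set[OF assms(1)] by (simp add: mult_2)

end
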